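(* Consider an $(\mathsf H,\mathsf r,\mathsf M,\mathsf N)$ combination network with end-user caches, and let $\mathsf K:=\binom{\mathsf H}{\mathsf r}$, $\mathsf K':=\binom{\mathsf H-1}{\mathsf r-1}$, $\mathsf K'':=\binom{\mathsf H}{\mathsf r-1}$. For each integer $g\in\{2,\ldots,\mathsf K'\}$ put $q:=\mathsf K'-g+1$. Then the lower convex envelope of the memory-load points $$(\mathsf M,\mathsf R)=\left(\mathsf N\,\frac{\binom{\mathsf K''-\mathsf r}{q}}{\binom{\mathsf K''-\mathsf r}{q}+\mathsf r\binom{\mathsf K'-1}{q-1}},\ \frac{\frac{\mathsf K}{\mathsf H}\left(1-\frac{\mathsf M}{\mathsf N}\right)}{g}\right),\qquad g\in\{2,\ldots,\mathsf K'\},$$ (where $\mathsf M$ in the second coordinate is the first coordinate of the same point) is achievable.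
   Context: Convention: $\binom{x}{y}=0$ if $x<0$ or $y<0$ or $x<y$. Combination network. Let $\mathsf H,\mathsf r,\mathsf N$ be positive integers with $\mathsf r\le \mathsf H$, and let $\mathsf M\in[0,\mathsf N]$. A server has $\mathsf N$ independent files $F_1,\ldots,F_{\mathsf N}$, each consisting of $\mathsf B$ i.i.d. uniformly distributed bits. The server is connected to $\mathsf H$ relays (without caches) through $\mathsf H$ error-free orthogonal links. There are $\mathsf K=\binom{\mathsf H}{\mathsf r}$ users; each user is connected to a distinct subset of exactly $\mathsf r$ relays through $\mathsf r$ error-free orthogonal links, and has a cache of $\mathsf M\mathsf B$ bits. $\mathcal H_k\subseteq[\mathsf H]$ (with $|\mathcal H_k|=\mathsf r$) denotes the set of relays connected to user $k$, and $\mathcal U_h\subseteq[\mathsf K]$ denotes the set of users connected to relay $h$, so $|\mathcal U_h|=\mathsf K'$. Placement phase: user $k$ stores a cache content $Z_k$ of at most $\mathsf M\mathsf B$ bits, a function of $(F_1,\ldots,F_{\mathsf N})$ chosen without knowledge of the demands; $\mathbf Z=(Z_1,\ldots,Z_{\mathsf K})$. Coded placement (arbitrary functions of the files) is allowed. Delivery phase: user $k$ requests file $d_k\in[\mathsf N]$, and the demand vector $\mathbf d=(d_1,\ldots,d_{\mathsf K})$ is revealed to all nodes. Given $(\mathbf d,\mathbf Z)$, the server sends to each relay $h$ a message $X_h$ of $\mathsf B\,\mathsf R_h(\mathbf d,\mathbf Z)$ bits (a function of the files, $\mathbf d$ and $\mathbf Z$). Relay $h$ then sends to each user $k\in\mathcal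 U_h$ a message $X_{h\to k}$ of $\mathsf B\,\mathsf R_{h\to k}(\mathbf d,\mathbf Z)$ bits, a function of $X_h$ given the (known) demand vector and placement. User $k$ must recover $F_{d_k}$ from $Z_k$ and $(X_{h\to k}:h\in\mathcal H_k)$ with probability tending to $1$ as $\mathsf B\to\infty$. The max-link load of a scheme is $\max_{\mathbf d\in[\mathsf N]^{\mathsf K}}\max_{h\in[\mathsf H],\,k\in\mathcal U_h}\max\{\mathsf R_h(\mathbf d,\mathbf Z),\mathsf R_{h\to k}(\mathbf d,\mathbf Z)\}$ (asymptotically as $\mathsf B\to\infty$). The optimal max-link load $\mathsf R^\star=\mathsf R^\star(\mathsf M)$ is the minimum (infimum) of the max-link load over all placements $\mathbf Z$ with cache size $\mathsf M$ and all delivery schemes meeting the decoding requirement. A point $(\mathsf M,\mathsf R)$ is achievable if $\mathsf R^\star(\mathsf M)\le\mathsf R$; a lower convex envelope of a set of points is achievable if every point on it is achievable. *)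

theory Defs
  imports "HOL-Probability.Probability"
begin

(* Files are 0, ..., N - 1, relays are 0, ..., H - 1 and users are 0, ..., (H choose r) - 1.
   The topology is a map conn :: nat => nat set, where conn k is the set of relays of user k. *)

type_synonym bits = "bool list"
type_synonym files = "nat \<Rightarrow> bits"
type_synonym demand = "nat \<Rightarrow> nat"

definition connection_map :: "nat \<Rightarrow> nat \<Rightarrow> (nat \<Rightarrow> nat set) \<Rightarrow> bool" where
  "connection_map H r conn \<longleftrightarrow>
     bij_betw conn {..<H choose r} {S. S \<subseteq> {..<H} \<and> card S = r}"

definition users_of_relay :: "nat \<Rightarrow> nat \<Rightarrow> (nat \<Rightarrow> nat set) \<Rightarrow> nat \<Rightarrow> nat set" where
  "users_of_relay H r conn h = {k. k < (H choose r) \<and> h \<in> conn k}"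

definition demands :: "nat \<Rightarrow> nat \<Rightarrow> nat \<Rightarrow> demand set" where
  "demands H r N = {..<H choose r} \<rightarrow>\<^sub>E {..<N}"

definition files_pmf :: "nat \<Rightarrow> nat \<Rightarrow> files pmf" where
  "files_pmf N B = Pi_pmf {..<N} [] (\<lambda>_. replicate_pmf B (bernoulli_pmf (1/2)))"

(* A code for one file length B. The three length fields are fixed in advance: they may depend
   on the demand (except for the cache), but not on the realization of the files, so that
   message lengths carry no information. The placement is an arbitrary function of the files,
   and server_msg c d F h may depend on the caches since these are functions of F. *)
record caching_code =
  cache_len :: "nat \<Rightarrow> nat"
  placement :: "files \<Rightarrow> nat \<Rightarrow> bits"
  server_len :: "demand \<Rightarrow> nat \<Rightarrow> nat"
  server_msg :: "demand \<Rightarrow> files \<Rightarrow> nat \<Rightarrow> bits"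
  relay_len :: "demand \<Rightarrow> nat \<Rightarrow> nat \<Rightarrow> nat"
  relay_msg :: "demand \<Rightarrow> nat \<Rightarrow> nat \<Rightarrow> bits \<Rightarrow> bits"
  decoder :: "demand \<Rightarrow> nat \<Rightarrow> bits \<Rightarrow> (nat \<Rightarrow> bits) \<Rightarrow> bits"

definition valid_code ::
    "nat \<Rightarrow> nat \<Rightarrow> nat \<Rightarrow> (nat \<Rightarrow> nat set) \<Rightarrow> real \<Rightarrow> nat \<Rightarrow> caching_code \<Rightarrow> bool" where
  "valid_code H r N conn M B c \<longleftrightarrow>
     (\<forall>k < H choose r. real (cache_len c k) \<le> M * real B) \<and>
     (\<forall>F \<in> set_pmf (files_pmf N B).
        (\<forall>k < H choose r. length (placement c F k) = cache_len c k) \<and>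
        (\<forall>d \<in> demands H r N. \<forall>h<H.
           length (server_msg c d F h) = server_len c d h \<and>
           (\<forall>k \<in> users_of_relay H r conn h.
              length (relay_msg c d h k (server_msg c d F h)) = relay_len c d h k)))"

(* The decoder of user k only sees the messages of the relays in conn k. *)
definition decoded_file ::
    "(nat \<Rightarrow> nat set) \<Rightarrow> caching_code \<Rightarrow> demand \<Rightarrow> nat \<Rightarrow> files \<Rightarrow> bits" where
  "decoded_file conn c d k F =
     decoder c d k (placement c F k)
       (restrict (\<lambda>h. relay_msg c d h k (server_msg c d F h)) (conn k))"

definition success_prob ::
    "nat \<Rightarrow> nat \<Rightarrow> (nat \<Rightarrow> nat set) \<Rightarrow> caching_code \<Rightarrow> demand \<Rightarrow> nat \<Rightarrow> real" where
  "success_prob N B conn c d k =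
     measure_pmf.prob (files_pmf N B) {F. decoded_file conn c d k F = F (d k)}"

definition max_link_load ::
    "nat \<Rightarrow> nat \<Rightarrow> nat \<Rightarrow> (nat \<Rightarrow> nat set) \<Rightarrow> nat \<Rightarrow> caching_code \<Rightarrow> real" where
  "max_link_load H r N conn B c =
     Max {max (real (server_len c d h) / real B) (real (relay_len c d h k) / real B) | d h k.
            d \<in> demands H r N \<and> h < H \<and> k \<in> users_of_relay H r conn h}"

(* A scheme is a sequence of codes, one for each file length B. *)
definition schemes ::
    "nat \<Rightarrow> nat \<Rightarrow> nat \<Rightarrow> (nat \<Rightarrow> nat set) \<Rightarrow> real \<Rightarrow> (nat \<Rightarrow> caching_code) set" where
  "schemes H r N conn M =
     {c. (\<forall>B>0. valid_code H r N conn M B (c B)) \<and>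
         (\<forall>d \<in> demands H r N. \<forall>k < H choose r.
            (\<lambda>B. success_prob N B conn (c B) d k) \<longlonglongrightarrow> 1)}"

definition optimal_load ::
    "nat \<Rightarrow> nat \<Rightarrow> nat \<Rightarrow> (nat \<Rightarrow> nat set) \<Rightarrow> real \<Rightarrow> ereal" where
  "optimal_load H r N conn M =
     (INF c \<in> schemes H r N conn M.
        limsup (\<lambda>B. ereal (max_link_load H r N conn B (c B))))"

definition achievable ::
    "nat \<Rightarrow> nat \<Rightarrow> nat \<Rightarrow> (nat \<Rightarrow> nat set) \<Rightarrow> real \<times> real \<Rightarrow> bool" where
  "achievable H r N conn p \<longleftrightarrow>
     0 \<le> fst p \<and> fst p \<le> real N \<and> optimal_load H r N conn (fst p) \<le> ereal (snd p)"

definition lower_convex_envelope :: "(real \<times> real) set \<Rightarrow> (real \<times> real) set" where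
  "lower_convex_envelope S =
     {(x, y). (x, y) \<in> convex hull S \<and> (\<forall>y'. (x, y') \<in> convex hull S \<longrightarrow> y \<le> y')}"

end

theory Submission
  imports Defs
begin

text \<open>Identify user \<open>k\<close>, as seen from relay \<open>h\<close>, with the \<open>(r - 1)\<close>-set \<open>conn k - {h}\<close>, and let
  \<open>q = K' - g + 1\<close>. Each file is encoded by an MDS code into symbols indexed by the \<open>q\<close>-sets of
  \<open>(r - 1)\<close>-sets of relays, any \<open>D = ((K'' - r) choose q) + r * ((K' - 1) choose (q - 1))\<close> of which
  determine the file. User \<open>k\<close> caches the symbols whose index avoids its own \<open>r\<close> labels. For every
  \<open>g\<close>-set \<open>P\<close> of labels at relay \<open>h\<close>, the relay multicasts the sum modulo \<open>2 ^ L\<close> (playing the role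
  of XOR) over \<open>T \<in> P\<close> of the symbol with index \<open>insert T (relay_labels h - P)\<close> of the file
  requested by the user with label \<open>T\<close>; each user in \<open>P\<close> has cached all summands but its own.
  The bits lost to rounding are bounded independently of \<open>B\<close> and are sent uncached.
  Points in the convex hull follow by memory sharing.\<close>

section \<open>Bit strings and an MDS code over the integers\<close>

text \<open>Two numbers whose shifted residues agree differ by a multiple of \<open>M\<close>, yet
  both lie below \<open>M\<close>. A receiver cancels its cached summands from a multicast sum in
  this way.\<close>

lemma mod_add_right_imp_eq:
  fixes a b s M :: nat
  assumes "(a + s) mod M = (b + s) mod M" "a < M" "b < M"
  shows "a = b"
  using assms
proof (induction a b rule: linorder_wlog)
  case (le a b)
  then have "M dvd (b + s) - (a + s)"
    by (metis add_le_mono1 mod_eq_dvd_iff_nat)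
  then show ?case
    using le by (auto dest: dvd_imp_le)
qed simp

text \<open>Both sides have \<open>2 ^ (card A * L)\<close> elements.\<close>

lemma ex_bij_betw_bit_lists_funcset:
  fixes A :: "'a set"
  assumes "finite A"
  shows "\<exists>\<beta>. bij_betw \<beta> {xs :: bits. length xs = card A * L} (A \<rightarrow>\<^sub>E {..<(2::nat) ^ L})"
proof (rule finite_same_card_bij)
  have eq: "{xs :: bits. length xs = n} = {xs. set xs \<subseteq> UNIV \<and> length xs = n}" for n
    by simp
  show "finite {xs :: bits. length xs = card A * L}"
    unfolding eq by (rule finite_lists_length_eq) simp
  show "finite (A \<rightarrow>\<^sub>E {..<(2::nat) ^ L})"
    using assms by (simp add: finite_PiE)
  show "card {xs :: bits. length xs = card A * L} = card (A \<rightarrow>\<^sub>E {..<(2::nat) ^ L})"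
  proof -
    have "card {xs :: bits. length xs = card A * L} = 2 ^ (card A * L)"
      unfolding eq by (subst card_lists_length_eq) simp_all
    also have "\<dots> = (2 ^ L) ^ card A"
      by (subst mult.commute) (rule power_mult)
    finally show ?thesis
      using assms by (simp add: card_PiE)
  qed
qed

text \<open>Serializes a family of \<open>L\<close>-bit numbers. Only injectivity and the exact
  length matter, so an arbitrary bijection serves; \<open>restrict\<close> allows total functions to
  be passed.\<close>

definition pack :: "nat \<Rightarrow> 'a set \<Rightarrow> ('a \<Rightarrow> nat) \<Rightarrow> bits" where
  "pack L A f = inv_into {xs. length xs = card A * L}
     (SOME \<beta>. bij_betw \<beta> {xs :: bits. length xs = card A * L} (A \<rightarrow>\<^sub>E {..<(2::nat) ^ L})) (restrict f A)"

lemma bij_betw_pack: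
  assumes "finite A"
  shows "bij_betw (pack L A) (A \<rightarrow>\<^sub>E {..<2 ^ L}) {xs. length xs = card A * L}"
proof -
  define \<beta> where "\<beta> = (SOME \<beta>. bij_betw \<beta> {xs :: bits. length xs = card A * L} (A \<rightarrow>\<^sub>E {..<(2::nat) ^ L}))"
  have "bij_betw \<beta> {xs :: bits. length xs = card A * L} (A \<rightarrow>\<^sub>E {..<(2::nat) ^ L})"
    unfolding \<beta>_def by (rule someI_ex[OF ex_bij_betw_bit_lists_funcset[OF assms]])
  then have "bij_betw (inv_into {xs. length xs = card A * L} \<beta>) (A \<rightarrow>\<^sub>E {..<2 ^ L}) {xs. length xs = card A * L}"
    by (rule bij_betw_inv_into)
  moreover have "pack L A f = inv_into {xs. length xs = card A * L} \<beta> f" if "f \<in> A \<rightarrow>\<^sub>E {..<2 ^ L}" for f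
    using that by (simp add: pack_def \<beta>_def PiE_restrict)
  ultimately show ?thesis
    by (simp cong: bij_betw_cong)
qed

lemma pack_restrict: "pack L A (restrict f A) = pack L A f"
  by (simp add: pack_def)

lemma length_pack:
  assumes "finite A" "\<And>a. a \<in> A \<Longrightarrow> f a < 2 ^ L"
  shows "length (pack L A f) = card A * L"
proof -
  have "restrict f A \<in> A \<rightarrow>\<^sub>E {..<2 ^ L}"
    using assms(2) by auto
  then have "pack L A (restrict f A) \<in> {xs. length xs = card A * L}"
    using bij_betwE[OF bij_betw_pack[OF assms(1)]] by blast
  then show ?thesis
    by (simp add: pack_restrict)
qed

lemma pack_inject:
  assumes "finite A" "\<And>a. a \<in> A \<Longrightarrow> f a < 2 ^ L" "\<And>a. a \<in> A \<Longrightarrow> g a < 2 ^ L"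
    and "pack L A f = pack L A g" "a \<in> A"
  shows "f a = g a"
proof -
  have "restrict f A \<in> A \<rightarrow>\<^sub>E {..<2 ^ L}" "restrict g A \<in> A \<rightarrow>\<^sub>E {..<2 ^ L}"
    using assms(2,3) by auto
  moreover have "pack L A (restrict f A) = pack L A (restrict g A)"
    using assms(4) by (simp add: pack_restrict)
  ultimately have "restrict f A = restrict g A"
    using bij_betw_imp_inj_on[OF bij_betw_pack[OF assms(1), of L]] by (metis inj_onD)
  then show ?thesis
    using assms(5) by (metis restrict_apply')
qed

text \<open>Polynomial evaluation at distinct naturals is MDS by interpolation. Working over the integers
  instead of a finite field costs only a number \<open>c\<close> of extra bits per symbol that does not depend on
  the symbol size \<open>m\<close>.\<close>

lemma ex_mds_code:
  fixes I :: "'a set" and D :: nat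
  assumes "finite I" "0 < D"
  obtains c where "\<And>m. \<exists>enc :: bits \<Rightarrow> 'a \<Rightarrow> nat.
    (\<forall>x i. length x = D * m \<longrightarrow> i \<in> I \<longrightarrow> enc x i < 2 ^ (m + c)) \<and>
    (\<forall>x y J. length x = D * m \<longrightarrow> length y = D * m \<longrightarrow> J \<subseteq> I \<longrightarrow> card J = D \<longrightarrow>
       (\<forall>i\<in>J. enc x i = enc y i) \<longrightarrow> x = y)"
proof -
  obtain \<iota> :: "'a \<Rightarrow> nat" where inj: "inj_on \<iota> I"
    using assms(1) finite_imp_inj_to_nat_seg by blast
  define X where "X = (\<Sum>i\<in>I. \<iota> i)"
  have X: "\<iota> i \<le> X" if "i \<in> I" for i
    unfolding X_def using that assms(1) by (intro member_le_sum) auto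
  \<comment> \<open>Every value of the encoding polynomial will be at most \<open>2 ^ m * c\<close>,
    and \<open>c < 2 ^ c\<close>. Hence \<open>c\<close> extra bits suffice for all \<open>m\<close>
    at once.\<close>
  define c where "c = (\<Sum>j<D. X ^ j)"
  show ?thesis
  proof (rule that[of c])
    fix m
    obtain \<beta> where \<beta>: "bij_betw \<beta> {xs :: bits. length xs = D * m} ({..<D} \<rightarrow>\<^sub>E {..<(2::nat) ^ m})"
      using ex_bij_betw_bit_lists_funcset[of "{..<D}" m] by auto
    have coeff: "\<beta> x j < 2 ^ m" if "length x = D * m" "j < D" for x j
      using bij_betwE[OF \<beta>] that by (auto simp: PiE_iff)
    \<comment> \<open>Through \<beta> the string \<open>x\<close> becomes \<open>D\<close>
      coefficients of \<open>m\<close> bits each; the symbol with index \<open>i\<close> is the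
      value of that polynomial at \<open>\<iota> i\<close>.\<close>
    define enc where "enc x i = (\<Sum>j<D. \<beta> x j * \<iota> i ^ j)" for x i
    have bound: "enc x i < 2 ^ (m + c)" if "length x = D * m" "i \<in> I" for x i
    proof -
      have "enc x i \<le> (\<Sum>j<D. 2 ^ m * X ^ j)"
        unfolding enc_def using coeff[OF that(1)] X[OF that(2)]
        by (intro sum_mono mult_mono power_mono) (auto intro: less_imp_le)
      also have "\<dots> = 2 ^ m * c"
        by (simp add: c_def sum_distrib_left)
      also have "\<dots> < 2 ^ m * 2 ^ c"
        by (simp add: less_exp)
      finally show ?thesis
        by (simp add: power_add)
    qed
    have interpolation: "x = y"
      if x: "length x = D * m" and y: "length y = D * m" and J: "J \<subseteq> I" "card J = D"
        and eq: "\<forall>i\<in>J. enc x i = enc y i" for x y J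
    proof (rule ccontr)
      assume "x \<noteq> y"
      \<comment> \<open>These are the coefficients of the difference polynomial. It is nonzero of
        degree at most \<open>D - 1\<close>, but vanishes at the \<open>D\<close> distinct points
        \<open>\<iota> i\<close> with \<open>i\<close> in \<open>J\<close>.\<close>
      define a where "a j = real (\<beta> x j) - real (\<beta> y j)" for j
      have "\<beta> x \<noteq> \<beta> y"
        using \<open>x \<noteq> y\<close> bij_betw_imp_inj_on[OF \<beta>] x y by (auto dest: inj_onD)
      moreover have "\<beta> x \<in> {..<D} \<rightarrow>\<^sub>E {..<2 ^ m}" "\<beta> y \<in> {..<D} \<rightarrow>\<^sub>E {..<2 ^ m}"
        using bij_betwE[OF \<beta>] x y by auto
      ultimately obtain k where k: "k < D" "\<beta> x k \<noteq> \<beta> y k"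
        by (metis PiE_ext lessThan_iff)
      obtain n where n: "D = Suc n"
        using assms(2) gr0_implies_Suc by blast
      let ?Z = "{z. (\<Sum>j\<le>n. a j * z ^ j) = 0}"
      have Z: "finite ?Z \<and> card ?Z \<le> n"
        by (rule Transcendental.polyfun_rootbound[of a k]) (use k n in \<open>auto simp: a_def\<close>)
      have "(\<lambda>i. real (\<iota> i)) ` J \<subseteq> ?Z"
      proof clarify
        fix i assume "i \<in> J"
        then have "real (enc x i) = real (enc y i)"
          using eq by simp
        then show "(\<Sum>j\<le>n. a j * real (\<iota> i) ^ j) = 0"
          by (simp add: enc_def a_def left_diff_distrib sum_subtractf n lessThan_Suc_atMost)
      qed
      moreover have "card ((\<lambda>i. real (\<iota> i)) ` J) = D"
        using J inj by (subst card_image) (auto simp: inj_on_def)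
      ultimately have "D \<le> card ?Z"
        using Z by (metis card_mono)
      then show False
        using Z n by linarith
    qed
    show "\<exists>enc :: bits \<Rightarrow> 'a \<Rightarrow> nat.
        (\<forall>x i. length x = D * m \<longrightarrow> i \<in> I \<longrightarrow> enc x i < 2 ^ (m + c)) \<and>
        (\<forall>x y J. length x = D * m \<longrightarrow> length y = D * m \<longrightarrow> J \<subseteq> I \<longrightarrow> card J = D \<longrightarrow>
           (\<forall>i\<in>J. enc x i = enc y i) \<longrightarrow> x = y)"
      by (rule exI[of _ enc]) (use bound interpolation in blast)
  qed
qed

section \<open>Zero-error codes\<close>

text \<open>A superset of the support of \<open>files_pmf\<close>: correct decoding on all of it
  yields success probability 1.\<close>

definition files_of_length :: "nat \<Rightarrow> nat \<Rightarrow> files set" where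
  "files_of_length N B = {F. \<forall>i<N. length (F i) = B}"

lemma set_files_pmf_subset: "set_pmf (files_pmf N B) \<subseteq> files_of_length N B"
  by (auto simp: files_pmf_def files_of_length_def set_Pi_pmf PiE_dflt_def set_replicate_pmf)

locale combination_network =
  fixes H r N :: nat and conn :: "nat \<Rightarrow> nat set"
  assumes H_pos: "0 < H" and r_pos: "0 < r" and r_le_H: "r \<le> H" and N_pos: "0 < N"
    and conn: "connection_map H r conn"
begin

lemma bij_conn: "bij_betw conn {..<H choose r} {S. S \<subseteq> {..<H} \<and> card S = r}"
  using conn by (simp add: connection_map_def)

lemma conn_subset: "k < H choose r \<Longrightarrow> conn k \<subseteq> {..<H}"
  and card_conn: "k < H choose r \<Longrightarrow> card (conn k) = r"
  using bij_betwE[OF bij_conn] by auto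

lemma finite_conn: "k < H choose r \<Longrightarrow> finite (conn k)"
  using card_conn r_pos card_ge_0_finite by metis

definition user :: "nat set \<Rightarrow> nat" where
  "user = inv_into {..<H choose r} conn"

lemma user_less: "S \<subseteq> {..<H} \<Longrightarrow> card S = r \<Longrightarrow> user S < H choose r"
  using bij_betwE[OF bij_betw_inv_into[OF bij_conn]] by (auto simp: user_def)

lemma user_conn: "k < H choose r \<Longrightarrow> user (conn k) = k"
  using bij_betw_inv_into_left[OF bij_conn] by (auto simp: user_def)

text \<open>Relays forward everything they receive, and a decoder exists as soon as the observations of a
  user determine the file.\<close>

definition zero_error_scheme ::
    "nat \<Rightarrow> nat \<Rightarrow> nat \<Rightarrow> (files \<Rightarrow> nat \<Rightarrow> bits) \<Rightarrow> (demand \<Rightarrow> files \<Rightarrow> nat \<Rightarrow> bits) \<Rightarrow> bool" where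
  "zero_error_scheme B a s Z X \<longleftrightarrow>
     (\<forall>F\<in>files_of_length N B. \<forall>k<H choose r. length (Z F k) = a) \<and>
     (\<forall>d\<in>demands H r N. \<forall>F\<in>files_of_length N B. \<forall>h<H. length (X d F h) = s) \<and>
     (\<forall>d\<in>demands H r N. \<forall>k<H choose r. \<forall>F\<in>files_of_length N B. \<forall>F'\<in>files_of_length N B.
        Z F k = Z F' k \<longrightarrow> (\<forall>h\<in>conn k. X d F h = X d F' h) \<longrightarrow> F (d k) = F' (d k))"

definition zero_error_code :: "nat \<Rightarrow> nat \<Rightarrow> nat \<Rightarrow> bool" where
  "zero_error_code B a s \<longleftrightarrow> (\<exists>Z X. zero_error_scheme B a s Z X)"

lemma zero_error_schemeD:
  assumes "zero_error_scheme B a s Z X"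
  shows "F \<in> files_of_length N B \<Longrightarrow> k < H choose r \<Longrightarrow> length (Z F k) = a"
    and "d \<in> demands H r N \<Longrightarrow> F \<in> files_of_length N B \<Longrightarrow> h < H \<Longrightarrow> length (X d F h) = s"
    and "d \<in> demands H r N \<Longrightarrow> k < H choose r \<Longrightarrow> F \<in> files_of_length N B \<Longrightarrow>
      F' \<in> files_of_length N B \<Longrightarrow> Z F k = Z F' k \<Longrightarrow> (\<And>h. h \<in> conn k \<Longrightarrow> X d F h = X d F' h) \<Longrightarrow>
      F (d k) = F' (d k)"
  using assms unfolding zero_error_scheme_def by blast+

lemma zero_error_codeI:
  fixes Z :: "files \<Rightarrow> nat \<Rightarrow> bits" and X :: "demand \<Rightarrow> files \<Rightarrow> nat \<Rightarrow> bits"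
  assumes "\<And>F k. F \<in> files_of_length N B \<Longrightarrow> k < H choose r \<Longrightarrow> length (Z F k) = a"
    and "\<And>d F h. d \<in> demands H r N \<Longrightarrow> F \<in> files_of_length N B \<Longrightarrow> h < H \<Longrightarrow> length (X d F h) = s"
    and "\<And>d k F F'. d \<in> demands H r N \<Longrightarrow> k < H choose r \<Longrightarrow> F \<in> files_of_length N B \<Longrightarrow>
      F' \<in> files_of_length N B \<Longrightarrow> Z F k = Z F' k \<Longrightarrow> \<forall>h\<in>conn k. X d F h = X d F' h \<Longrightarrow>
      F (d k) = F' (d k)"
  shows "zero_error_code B a s"
  unfolding zero_error_code_def zero_error_scheme_def
  by (rule exI[of _ Z], rule exI[of _ X]) (use assms in simp)

lemma demand_less: "d \<in> demands H r N \<Longrightarrow> k < H choose r \<Longrightarrow> d k < N"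
  by (auto simp: demands_def PiE_iff)

text \<open>Every relay sends the whole library. This is wasteful, but it is applied only to pieces
  of bounded length, where it costs a constant.\<close>

lemma zero_error_code_uncached: "zero_error_code B 0 (N * B)"
proof -
  let ?X = "\<lambda>(d::demand) (F::files) (h::nat). concat (map F [0..<N])"
  have len: "length (concat (map F [0..<N])) = N * B" if "F \<in> files_of_length N B" for F
  proof -
    have "map (length \<circ> F) [0..<N] = replicate N B"
      using that by (intro nth_equalityI) (auto simp: files_of_length_def)
    then show ?thesis
      by (simp add: length_concat sum_list_replicate)
  qed
  have dec: "F (d k) = F' (d k)"
    if "d \<in> demands H r N" "k < H choose r" "F \<in> files_of_length N B" "F' \<in> files_of_length N B"
      "\<forall>h\<in>conn k. ?X d F h = ?X d F' h" for d k F F'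
  proof -
    have "conn k \<noteq> {}"
      using card_conn[OF that(2)] r_pos by auto
    then have "concat (map F [0..<N]) = concat (map F' [0..<N])"
      using that(5) by blast
    then have "map F [0..<N] = map F' [0..<N]"
      \<comment> \<open>Corresponding blocks have the same length \<open>B\<close>, so the
        concatenation can be cut back into the files.\<close>
      by (rule concat_injective) (use that(3,4) in \<open>auto simp: files_of_length_def set_zip\<close>)
    then show ?thesis
      using demand_less[OF that(1,2)] by simp
  qed
  show ?thesis
    by (rule zero_error_codeI[where Z = "\<lambda>_ _. []" and X = ?X]) (use len dec in simp_all)
qed

text \<open>Each file is cut after \<open>B1\<close> bits and the two codes run side by side.
  Because the lengths \<open>a1\<close> and \<open>s1\<close> are fixed, every concatenated string
  splits uniquely.\<close>

lemma zero_error_code_add: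
  assumes "zero_error_code B1 a1 s1" "zero_error_code B2 a2 s2"
  shows "zero_error_code (B1 + B2) (a1 + a2) (s1 + s2)"
proof -
  obtain Z1 X1 Z2 X2 where
    1: "zero_error_scheme B1 a1 s1 Z1 X1" and 2: "zero_error_scheme B2 a2 s2 Z2 X2"
    using assms unfolding zero_error_code_def by blast
  note len = zero_error_schemeD(1,2)[OF 1] zero_error_schemeD(1,2)[OF 2]
  define p1 :: "files \<Rightarrow> files" where "p1 F = (\<lambda>i. take B1 (F i))" for F
  define p2 :: "files \<Rightarrow> files" where "p2 F = (\<lambda>i. drop B1 (F i))" for F
  have p1: "p1 F \<in> files_of_length N B1" and p2: "p2 F \<in> files_of_length N B2"
    if "F \<in> files_of_length N (B1 + B2)" for F
    using that by (auto simp: p1_def p2_def files_of_length_def)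
  let ?Z = "\<lambda>F k. Z1 (p1 F) k @ Z2 (p2 F) k" and ?X = "\<lambda>d F h. X1 d (p1 F) h @ X2 d (p2 F) h"
  have dec: "F (d k) = F' (d k)"
    if d: "d \<in> demands H r N" and k: "k < H choose r"
      and F: "F \<in> files_of_length N (B1 + B2)" and F': "F' \<in> files_of_length N (B1 + B2)"
      and Z: "?Z F k = ?Z F' k" and X: "\<forall>h\<in>conn k. ?X d F h = ?X d F' h" for d k F F'
  proof -
    note P = p1[OF F] p1[OF F'] p2[OF F] p2[OF F']
    have "Z1 (p1 F) k = Z1 (p1 F') k" "Z2 (p2 F) k = Z2 (p2 F') k"
      using Z P k by (simp_all add: len)
    moreover have "X1 d (p1 F) h = X1 d (p1 F') h \<and> X2 d (p2 F) h = X2 d (p2 F') h"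
      if "h \<in> conn k" for h
    proof -
      have "h < H"
        using that conn_subset[OF k] by auto
      then show ?thesis
        using bspec[OF X that] P d by (simp add: len)
    qed
    ultimately have "p1 F (d k) = p1 F' (d k)" "p2 F (d k) = p2 F' (d k)"
      using zero_error_schemeD(3)[OF 1 d k P(1,2)] zero_error_schemeD(3)[OF 2 d k P(3,4)]
      by blast+
    then show ?thesis
      unfolding p1_def p2_def by (metis append_take_drop_id)
  qed
  show ?thesis
  proof (rule zero_error_codeI[where Z = ?Z and X = ?X])
    show "F (d k) = F' (d k)"
      if "d \<in> demands H r N" "k < H choose r" "F \<in> files_of_length N (B1 + B2)"
        "F' \<in> files_of_length N (B1 + B2)" "?Z F k = ?Z F' k" "\<forall>h\<in>conn k. ?X d F h = ?X d F' h"
      for d k F F'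
      using that by (rule dec)
  qed (use p1 p2 len in simp_all)
qed

text \<open>The decoder picks any library compatible with what the user observes; by zero error, its
  entry for the demanded file is already correct.\<close>

lemma code_of_zero_error_code:
  assumes "zero_error_code B a s" "real a \<le> M * real B"
  obtains c where "valid_code H r N conn M B c"
    and "\<And>d k. d \<in> demands H r N \<Longrightarrow> k < H choose r \<Longrightarrow> success_prob N B conn c d k = 1"
    and "max_link_load H r N conn B c = real s / real B"
proof -
  obtain Z X where scheme: "zero_error_scheme B a s Z X"
    using assms(1) unfolding zero_error_code_def by blast
  note len = zero_error_schemeD(1,2)[OF scheme]
  define obs where "obs d k F = restrict (X d F) (conn k)" for d k F
  define c where "c = \<lparr>cache_len = \<lambda>_. a, placement = Z, server_len = \<lambda>_ _. s, server_msg = X,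
    relay_len = \<lambda>_ _ _. s, relay_msg = \<lambda>_ _ _ x. x,
    decoder = \<lambda>d k z x. (SOME F. F \<in> files_of_length N B \<and> Z F k = z \<and> obs d k F = x) (d k)\<rparr>"
  have files: "F \<in> files_of_length N B" if "F \<in> set_pmf (files_pmf N B)" for F
    using that set_files_pmf_subset by blast
  show ?thesis
  proof (rule that[of c])
    show "valid_code H r N conn M B c"
      using assms(2) len files by (auto simp: valid_code_def c_def)
    show "success_prob N B conn c d k = 1" if d: "d \<in> demands H r N" and k: "k < H choose r" for d k
    proof -
      have "decoded_file conn c d k F = F (d k)" if "F \<in> set_pmf (files_pmf N B)" for F
      proof -
        let ?P = "\<lambda>G. G \<in> files_of_length N B \<and> Z G k = Z F k \<and> obs d k G = obs d k F"
        define G where "G = (SOME G. ?P G)"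
        have F: "F \<in> files_of_length N B"
          using that by (rule files)
        then have "?P G"
          unfolding G_def by (intro someI[of ?P F]) simp
        then have G: "G \<in> files_of_length N B" "Z G k = Z F k" "obs d k G = obs d k F"
          by auto
        have "X d G h = X d F h" if "h \<in> conn k" for h
          using G(3) that unfolding obs_def by (metis restrict_apply')
        then have "G (d k) = F (d k)"
          by (rule zero_error_schemeD(3)[OF scheme d k G(1) F G(2)])
        then show ?thesis
          by (simp add: decoded_file_def c_def G_def obs_def)
      qed
      then have "AE F in files_pmf N B. decoded_file conn c d k F = F (d k)"
        by (simp add: AE_measure_pmf_iff)
      then show ?thesis
        unfolding success_prob_def by (subst measure_pmf.prob_eq_1) auto
    qed
    let ?S = "{max (real (server_len c d h) / real B) (real (relay_len c d h k) / real B) | d h k.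
       d \<in> demands H r N \<and> h < H \<and> k \<in> users_of_relay H r conn h}"
    \<comment> \<open>All lengths equal \<open>s\<close>, so only nonemptiness is at stake: user 0,
      one of its relays and the all-zero demand supply an element.\<close>
    have "?S = {real s / real B}"
    proof -
      have "0 < H choose r"
        using r_le_H by simp
      moreover from this obtain h where "h \<in> conn 0"
        using card_conn[of 0] r_pos by (metis card.empty ex_in_conv less_numeral_extra(3))
      ultimately have "0 \<in> users_of_relay H r conn h" "h < H"
        using conn_subset[of 0] by (auto simp: users_of_relay_def)
      moreover have "restrict (\<lambda>_. 0) {..<H choose r} \<in> demands H r N"
        using N_pos by (auto simp: demands_def)
      ultimately have "\<exists>d h k. d \<in> demands H r N \<and> h < H \<and> k \<in> users_of_relay H r conn h"
        by blast
      then show ?thesis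
        by (auto simp: c_def)
    qed
    then show "max_link_load H r N conn B c = real s / real B"
      unfolding max_link_load_def by simp
  qed
qed

section \<open>Memory sharing\<close>

text \<open>The cache bound is exact, as \<open>valid_code\<close> demands it for each
  \<open>B\<close>, whereas the load may exceed its target by a constant number of bits. Such
  constants add up under memory sharing and vanish after division by \<open>B\<close>.\<close>

definition uniformly_achievable :: "(real \<times> real) set" where
  "uniformly_achievable = {(M, R). 0 \<le> M \<and> M \<le> real N \<and> (\<exists>C. \<forall>B. \<exists>a s. zero_error_code B a s \<and>
     real a \<le> M * real B \<and> real s \<le> R * real B + C)}"

lemma achievable_if_uniformly_achievable:
  assumes "p \<in> uniformly_achievable"
  shows "achievable H r N conn p"
proof -
  obtain M R C where p: "p = (M, R)" "0 \<le> M" "M \<le> real N"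
    and C: "\<And>B. \<exists>a s. zero_error_code B a s \<and> real a \<le> M * real B \<and> real s \<le> R * real B + C"
    using assms unfolding uniformly_achievable_def by blast
  have "\<exists>c. valid_code H r N conn M B c \<and>
      (\<forall>d\<in>demands H r N. \<forall>k<H choose r. success_prob N B conn c d k = 1) \<and>
      (0 < B \<longrightarrow> max_link_load H r N conn B c \<le> R + C / real B)" for B
  proof -
    obtain a s where as: "zero_error_code B a s" "real a \<le> M * real B" "real s \<le> R * real B + C"
      using C by blast
    have "real s / real B \<le> R + C / real B" if "0 < B"
      using as(3) that by (simp add: field_simps)
    then show ?thesis
      using code_of_zero_error_code[OF as(1,2)] by metis
  qed
  then obtain c where valid: "\<And>B. valid_code H r N conn M B (c B)"
    and succ: "\<And>B d k. d \<in> demands H r N \<Longrightarrow> k < H choose r \<Longrightarrow> success_prob N B conn (c B) d k = 1"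
    and load: "\<And>B. 0 < B \<Longrightarrow> max_link_load H r N conn B (c B) \<le> R + C / real B"
    by metis
  have "c \<in> schemes H r N conn M"
    using valid succ by (simp add: schemes_def)
  then have "optimal_load H r N conn M \<le> limsup (\<lambda>B. ereal (max_link_load H r N conn B (c B)))"
    unfolding optimal_load_def by (rule INF_lower)
  also have "\<dots> \<le> limsup (\<lambda>B. ereal (R + C / real B))"
    using load by (intro Limsup_mono eventually_mono[OF eventually_gt_at_top[of 0]]) auto
  also have "\<dots> = ereal R"
  proof (rule lim_imp_Limsup)
    have "(\<lambda>B. R + C / real B) \<longlonglongrightarrow> R + 0"
      by (intro tendsto_add tendsto_const lim_const_over_n)
    then show "(\<lambda>B. ereal (R + C / real B)) \<longlonglongrightarrow> ereal R"
      by simp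
  qed simp
  finally show ?thesis
    using p by (simp add: achievable_def)
qed

text \<open>The file is split at \<open>nat \<lfloor>u * real B\<rfloor>\<close>; rounding down is compatible with the exact cache
  constraint when the first point has the larger memory.\<close>

lemma uniformly_achievable_share:
  assumes "(M1, R1) \<in> uniformly_achievable" "(M2, R2) \<in> uniformly_achievable"
    and "M2 \<le> M1" "0 \<le> u" "0 \<le> v" "u + v = 1"
  shows "(u * M1 + v * M2, u * R1 + v * R2) \<in> uniformly_achievable"
proof -
  obtain C1 where C1: "\<And>B. \<exists>a s. zero_error_code B a s \<and> real a \<le> M1 * real B \<and> real s \<le> R1 * real B + C1"
    and M1: "0 \<le> M1" "M1 \<le> real N"
    using assms(1) unfolding uniformly_achievable_def by blast
  obtain C2 where C2: "\<And>B. \<exists>a s. zero_error_code B a s \<and> real a \<le> M2 * real B \<and> real s \<le> R2 * real B + C2"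
    and M2: "0 \<le> M2" "M2 \<le> real N"
    using assms(2) unfolding uniformly_achievable_def by blast
  have "\<exists>a s. zero_error_code B a s \<and> real a \<le> (u * M1 + v * M2) * real B \<and>
      real s \<le> (u * R1 + v * R2) * real B + (C1 + C2 + \<bar>R2 - R1\<bar>)" for B
  proof -
    define B1 where "B1 = nat \<lfloor>u * real B\<rfloor>"
    have B1: "real B1 \<le> u * real B" "u * real B - 1 \<le> real B1"
      unfolding B1_def using assms(4) by simp_all
    have "u * real B \<le> 1 * real B"
      using assms by (intro mult_right_mono) auto
    then have "B1 \<le> B"
      using B1(1) by linarith
    then obtain B2 where B2: "B = B1 + B2"
      using le_Suc_ex by blast
    obtain a1 s1 where 1: "zero_error_code B1 a1 s1" "real a1 \<le> M1 * real B1"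
      "real s1 \<le> R1 * real B1 + C1"
      using C1 by blast
    obtain a2 s2 where 2: "zero_error_code B2 a2 s2" "real a2 \<le> M2 * real B2"
      "real s2 \<le> R2 * real B2 + C2"
      using C2 by blast
    have v: "v = 1 - u" and B2': "real B2 = real B - real B1"
      using assms(6) B2 by auto
    have "(M1 - M2) * real B1 \<le> (M1 - M2) * (u * real B)"
      using assms(3) B1(1) by (intro mult_left_mono) auto
    then have "real (a1 + a2) \<le> (u * M1 + v * M2) * real B"
      using 1(2) 2(2) unfolding v B2' by (simp add: algebra_simps)
    \<comment> \<open>Rounding moves at most one bit of each file from the first code to the second,
      which changes the load by at most \<open>\<bar>R2 - R1\<bar>\<close>.\<close>
    moreover have "(R2 - R1) * (u * real B - real B1) \<le> \<bar>R2 - R1\<bar> * 1"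
      by (rule order_trans[OF mult_right_mono[OF abs_ge_self] mult_left_mono]) (use B1 in auto)
    then have "real (s1 + s2) \<le> (u * R1 + v * R2) * real B + (C1 + C2 + \<bar>R2 - R1\<bar>)"
      using 1(3) 2(3) unfolding v B2' by (simp add: algebra_simps)
    ultimately show ?thesis
      using zero_error_code_add[OF 1(1) 2(1)] B2 by blast
  qed
  moreover have "0 \<le> u * M1 + v * M2"
    using assms M1 M2 by simp
  moreover have "u * M1 + v * M2 \<le> u * real N + v * real N"
    using assms M1 M2 by (intro add_mono mult_left_mono)
  then have "u * M1 + v * M2 \<le> real N"
    using assms(6) by (simp flip: distrib_right)
  ultimately show ?thesis
    unfolding uniformly_achievable_def by blast
qed

lemma convex_uniformly_achievable: "convex uniformly_achievable"
proof (rule convexI)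
  fix p1 p2 :: "real \<times> real" and u v :: real
  assume A: "p1 \<in> uniformly_achievable" "p2 \<in> uniformly_achievable" "0 \<le> u" "0 \<le> v" "u + v = 1"
  obtain M1 R1 M2 R2 where p: "p1 = (M1, R1)" "p2 = (M2, R2)"
    by (metis surj_pair)
  show "u *\<^sub>R p1 + v *\<^sub>R p2 \<in> uniformly_achievable"
  \<comment> \<open>The point with the larger memory has to come first in the sharing lemma;
    otherwise points and weights are swapped.\<close>
  proof (cases "M2 \<le> M1")
    case True
    then show ?thesis
      using uniformly_achievable_share[of M1 R1 M2 R2 u v] A by (simp add: p)
  next
    case False
    then show ?thesis
      using uniformly_achievable_share[of M2 R2 M1 R1 v u] A by (simp add: p add.commute)
  qed
qed

lemma achievable_lower_convex_envelope:
  assumes "S \<subseteq> uniformly_achievable"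
  shows "\<forall>p\<in>lower_convex_envelope S. achievable H r N conn p"
proof
  fix p assume "p \<in> lower_convex_envelope S"
  then have "p \<in> convex hull S"
    unfolding lower_convex_envelope_def by blast
  also have "\<dots> \<subseteq> uniformly_achievable"
    using assms convex_uniformly_achievable by (rule hull_minimal)
  finally show "achievable H r N conn p"
    by (rule achievable_if_uniformly_achievable)
qed

section \<open>Asymmetric placement of the coded symbols\<close>

definition labels :: "nat set set" where
  "labels = {T. T \<subseteq> {..<H} \<and> card T = r - 1}"

text \<open>Adding \<open>h\<close> to such a set gives the relay set of a user of \<open>h\<close>,
  so these labels enumerate the \<open>K'\<close> users of relay \<open>h\<close>.\<close>

definition relay_labels :: "nat \<Rightarrow> nat set set" where
  "relay_labels h = {T. T \<subseteq> {..<H} - {h} \<and> card T = r - 1}"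

definition own_labels :: "nat \<Rightarrow> nat set set" where
  "own_labels k = (\<lambda>h. conn k - {h}) ` conn k"

definition symbols :: "nat \<Rightarrow> nat set set set" where
  "symbols q = {V. V \<subseteq> labels \<and> card V = q}"

definition cached_symbols :: "nat \<Rightarrow> nat \<Rightarrow> nat set set set" where
  "cached_symbols q k = {V. V \<subseteq> labels - own_labels k \<and> card V = q}"

text \<open>The symbols that user \<open>k\<close> obtains through relay \<open>h\<close>.\<close>

definition delivered_symbols :: "nat \<Rightarrow> nat \<Rightarrow> nat \<Rightarrow> nat set set set" where
  "delivered_symbols q k h = {V. V \<subseteq> relay_labels h \<and> card V = q \<and> conn k - {h} \<in> V}"

lemma finite_labels: "finite labels"
  unfolding labels_def by simp

lemma card_labels: "card labels = H choose (r - 1)"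
  unfolding labels_def by (simp add: n_subsets)

lemma finite_relay_labels: "finite (relay_labels h)"
  unfolding relay_labels_def by simp

lemma card_relay_labels: "h < H \<Longrightarrow> card (relay_labels h) = (H - 1) choose (r - 1)"
  unfolding relay_labels_def by (simp add: n_subsets)

lemma relay_labels_subset: "relay_labels h \<subseteq> labels"
  unfolding relay_labels_def labels_def by auto

lemma own_label_in_relay_labels: "k < H choose r \<Longrightarrow> h \<in> conn k \<Longrightarrow> conn k - {h} \<in> relay_labels h"
  unfolding relay_labels_def using conn_subset card_conn finite_conn by auto

text \<open>Any other own label \<open>conn k - {h'}\<close> still contains \<open>h\<close>. Hence
  a set of labels at relay \<open>h\<close> avoids all own labels of \<open>k\<close> once it avoids
  this single one.\<close>

lemma own_labels_inter_relay_labels: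
  assumes "k < H choose r" "h \<in> conn k"
  shows "own_labels k \<inter> relay_labels h = {conn k - {h}}"
  using own_label_in_relay_labels[OF assms] assms unfolding own_labels_def relay_labels_def by auto

lemma card_own_labels:
  assumes "k < H choose r"
  shows "card (own_labels k) = r"
proof -
  have "inj_on (\<lambda>h. conn k - {h}) (conn k)"
    by (auto simp: inj_on_def)
  then show ?thesis
    unfolding own_labels_def using card_conn[OF assms] by (simp add: card_image)
qed

lemma own_labels_subset: "k < H choose r \<Longrightarrow> own_labels k \<subseteq> labels"
  unfolding own_labels_def using own_label_in_relay_labels relay_labels_subset by blast

lemma finite_symbols: "finite (symbols q)"
  unfolding symbols_def using finite_labels by simp

lemma cached_symbols_subset: "cached_symbols q k \<subseteq> symbols q"
  unfolding cached_symbols_def symbols_def by auto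

lemma delivered_symbols_subset: "delivered_symbols q k h \<subseteq> symbols q"
  unfolding delivered_symbols_def symbols_def using relay_labels_subset by auto

lemma card_cached_symbols:
  assumes "k < H choose r"
  shows "card (cached_symbols q k) = ((H choose (r - 1)) - r) choose q"
proof -
  have "card (labels - own_labels k) = (H choose (r - 1)) - r"
    using card_Diff_subset[OF finite_subset[OF own_labels_subset[OF assms] finite_labels]
        own_labels_subset[OF assms]] card_own_labels[OF assms] card_labels by simp
  then show ?thesis
    unfolding cached_symbols_def using finite_labels by (simp add: n_subsets)
qed

text \<open>One element of the index is forced to be the user's label; the other
  \<open>q - 1\<close> are chosen among the remaining \<open>K' - 1\<close> labels at the
  relay.\<close>

lemma card_delivered_symbols:
  assumes k: "k < H choose r" and h: "h \<in> conn k" and q: "0 < q"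
  shows "card (delivered_symbols q k h) = (((H - 1) choose (r - 1)) - 1) choose (q - 1)"
proof -
  let ?T = "conn k - {h}"
  have T: "?T \<in> relay_labels h"
    using own_label_in_relay_labels k h .
  have "bij_betw (insert ?T) {V. V \<subseteq> relay_labels h - {?T} \<and> card V = q - 1} (delivered_symbols q k h)"
  proof (rule bij_betwI[where g = "\<lambda>V. V - {?T}"])
    show "insert ?T \<in> {V. V \<subseteq> relay_labels h - {?T} \<and> card V = q - 1} \<rightarrow> delivered_symbols q k h"
    proof clarify
      fix V assume V: "V \<subseteq> relay_labels h - {?T}" "card V = q - 1"
      then have "finite V" "?T \<notin> V"
        using finite_relay_labels by (auto intro: finite_subset)
      then show "insert ?T V \<in> delivered_symbols q k h"
        using V T q by (auto simp: delivered_symbols_def)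
    qed
    show "(\<lambda>V. V - {?T}) \<in> delivered_symbols q k h \<rightarrow> {V. V \<subseteq> relay_labels h - {?T} \<and> card V = q - 1}"
      by (auto simp: delivered_symbols_def)
  qed (auto simp: delivered_symbols_def)
  then have "card (delivered_symbols q k h) = card {V. V \<subseteq> relay_labels h - {?T} \<and> card V = q - 1}"
    by (simp add: bij_betw_same_card)
  also have "\<dots> = card (relay_labels h - {?T}) choose (q - 1)"
    using finite_relay_labels by (intro n_subsets) simp
  also have "card (relay_labels h - {?T}) = ((H - 1) choose (r - 1)) - 1"
    using T card_relay_labels[of h] conn_subset[OF k] h finite_relay_labels by (simp add: subset_iff)
  finally show ?thesis .
qed

text \<open>Nothing is counted twice: delivered indices contain an own label while cached ones
  contain none, and \<open>conn k - {h}\<close> contains any other relay \<open>h'\<close> of the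
  user, so it is no label at \<open>h'\<close>. The total is the MDS threshold.\<close>

lemma card_known_symbols:
  assumes k: "k < H choose r" and q: "0 < q"
  shows "card (cached_symbols q k \<union> (\<Union>h\<in>conn k. delivered_symbols q k h)) =
    (((H choose (r - 1)) - r) choose q) + r * ((((H - 1) choose (r - 1)) - 1) choose (q - 1))"
proof -
  have fin: "finite (cached_symbols q k)" "\<And>h. finite (delivered_symbols q k h)"
    by (rule finite_subset[OF cached_symbols_subset finite_symbols])
      (rule finite_subset[OF delivered_symbols_subset finite_symbols])
  have "delivered_symbols q k h \<inter> delivered_symbols q k h' = {}"
    if "h \<in> conn k" "h' \<in> conn k" "h \<noteq> h'" for h h'
  proof -
    have "conn k - {h} \<notin> relay_labels h'"
      using that by (auto simp: relay_labels_def)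
    then show ?thesis
      by (auto simp: delivered_symbols_def)
  qed
  then have "card (\<Union>h\<in>conn k. delivered_symbols q k h) = (\<Sum>h\<in>conn k. card (delivered_symbols q k h))"
    using fin finite_conn[OF k] by (intro card_UN_disjoint) auto
  also have "\<dots> = r * ((((H - 1) choose (r - 1)) - 1) choose (q - 1))"
    using card_delivered_symbols[OF k _ q] card_conn[OF k] by simp
  finally have *: "card (\<Union>h\<in>conn k. delivered_symbols q k h) = \<dots>" .
  have "cached_symbols q k \<inter> (\<Union>h\<in>conn k. delivered_symbols q k h) = {}"
    by (auto simp: cached_symbols_def delivered_symbols_def own_labels_def)
  then show ?thesis
    using fin finite_conn[OF k] * card_cached_symbols[OF k] by (simp add: card_Un_disjoint)
qed

section \<open>Delivery with multicasting gain \<open>g\<close>\<close>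

text \<open>A file supplies \<open>D\<close> pieces of \<open>m\<close> bits and each coded symbol
  has \<open>m + c\<close> bits. A cache holds \<open>A\<close> symbols of every file, and a relay
  sends one symbol-sized sum for each \<open>g\<close>-set of its labels.\<close>

lemma zero_error_code_asymmetric:
  fixes g :: nat
  defines "K' \<equiv> (H - 1) choose (r - 1)"
  defines "q \<equiv> K' - g + 1"
  defines "A \<equiv> ((H choose (r - 1)) - r) choose q"
  defines "D \<equiv> A + r * ((K' - 1) choose (q - 1))"
  assumes g: "0 < g" "g \<le> K'"
  obtains c where "\<And>m. zero_error_code (D * m) (N * A * (m + c)) ((K' choose g) * (m + c))"
proof -
  \<comment> \<open>\<open>A\<close> may vanish, so positivity of \<open>D\<close> is drawn from its
    second summand.\<close>
  have "q - 1 \<le> K' - 1"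
    using g by (simp add: q_def)
  then have "0 < D"
    using r_pos by (simp add: D_def)
  obtain c where c: "\<And>m. \<exists>enc :: bits \<Rightarrow> nat set set \<Rightarrow> nat.
    (\<forall>x V. length x = D * m \<longrightarrow> V \<in> symbols q \<longrightarrow> enc x V < 2 ^ (m + c)) \<and>
    (\<forall>x y J. length x = D * m \<longrightarrow> length y = D * m \<longrightarrow> J \<subseteq> symbols q \<longrightarrow> card J = D \<longrightarrow>
       (\<forall>V\<in>J. enc x V = enc y V) \<longrightarrow> x = y)"
    using ex_mds_code[OF finite_symbols \<open>0 < D\<close>] by blast
  have "zero_error_code (D * m) (N * A * (m + c)) ((K' choose g) * (m + c))" for m
  proof -
    define L where "L = m + c"
    obtain enc :: "bits \<Rightarrow> nat set set \<Rightarrow> nat" where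
      enc: "\<And>x V. length x = D * m \<Longrightarrow> V \<in> symbols q \<Longrightarrow> enc x V < 2 ^ L"
      and mds: "\<And>x y J. length x = D * m \<Longrightarrow> length y = D * m \<Longrightarrow> J \<subseteq> symbols q \<Longrightarrow> card J = D \<Longrightarrow>
         (\<forall>V\<in>J. enc x V = enc y V) \<Longrightarrow> x = y"
      using c[of m] unfolding L_def by blast
    define CS where "CS k = {..<N} \<times> cached_symbols q k" for k
    define PS where "PS h = {P. P \<subseteq> relay_labels h \<and> card P = g}" for h
    have finCS: "finite (CS k)" for k
      unfolding CS_def using finite_subset[OF cached_symbols_subset finite_symbols] by simp
    have finPS: "finite (PS h)" for h
      unfolding PS_def using finite_relay_labels by simp
    \<comment> \<open>The user with label \<open>T\<close> at relay \<open>h\<close> has relay set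
      \<open>insert h T\<close>. For \<open>T\<close> in \<open>P\<close> the index has
      \<open>K' - g + 1 = q\<close> elements.\<close>
    define summand where "summand d F h P T =
      enc (F (d (user (insert h T)))) (insert T (relay_labels h - P))"
      for d :: demand and F :: files and h P T
    define multicast where "multicast d F h P = (\<Sum>T\<in>P. summand d F h P T) mod 2 ^ L" for d F h P
    let ?Z = "\<lambda>F k. pack L (CS k) (\<lambda>(i, V). enc (F i) V)" and ?X = "\<lambda>d F h. pack L (PS h) (multicast d F h)"
    have zbound: "(\<lambda>(i, V). enc (F i) V) a < 2 ^ L"
      if "F \<in> files_of_length N (D * m)" "a \<in> CS k" for F k a
      using that enc subsetD[OF cached_symbols_subset, of _ q k] by (auto simp: CS_def files_of_length_def)
    have xbound: "multicast d F h a < 2 ^ L" for d F h a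
      by (simp add: multicast_def)
    have lenZ: "length (?Z F k) = N * A * L" if "F \<in> files_of_length N (D * m)" "k < H choose r" for F k
      using length_pack[OF finCS zbound[OF that(1)]] card_cached_symbols[OF that(2), of q]
      by (simp add: CS_def A_def card_cartesian_product)
    have lenX: "length (?X d F h) = (K' choose g) * L" if "h < H" for d F h
      using length_pack[OF finPS xbound] n_subsets[OF finite_relay_labels, of h g] card_relay_labels[OF that]
      by (simp add: PS_def K'_def)
    have dec: "F (d k) = F' (d k)"
      if d: "d \<in> demands H r N" and k: "k < H choose r"
        and F: "F \<in> files_of_length N (D * m)" and F': "F' \<in> files_of_length N (D * m)"
        and Z: "?Z F k = ?Z F' k" and X: "\<forall>h\<in>conn k. ?X d F h = ?X d F' h" for d k F F'
    proof -
      have cached: "enc (F i) V = enc (F' i) V" if "i < N" "V \<in> cached_symbols q k" for i V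
        using pack_inject[OF finCS zbound[OF F] zbound[OF F'] Z, where a = "(i, V)"] that by (auto simp: CS_def)
      have delivered: "enc (F (d k)) V = enc (F' (d k)) V"
        if h: "h \<in> conn k" and V: "V \<in> delivered_symbols q k h" for h V
      proof -
        let ?T = "conn k - {h}"
        \<comment> \<open>This is the multicast group whose sum carries \<open>V\<close> to user
          \<open>k\<close>: the complement of \<open>V\<close> at the relay has \<open>g - 1\<close>
          labels, and the own label completes it.\<close>
        define P where "P = insert ?T (relay_labels h - V)"
        have hH: "h < H"
          using conn_subset[OF k] h by auto
        have V': "V \<subseteq> relay_labels h" "card V = q" "?T \<in> V"
          using V by (auto simp: delivered_symbols_def)
        have "finite V"
          using V'(1) finite_relay_labels finite_subset by blast
        have "card (relay_labels h - V) = K' - q"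
          using V' \<open>finite V\<close> card_relay_labels[OF hH] by (simp add: card_Diff_subset K'_def)
        then have "card P = g"
          unfolding P_def using V'(3) finite_relay_labels g by (simp add: q_def)
        moreover have "P \<subseteq> relay_labels h"
          using V' by (auto simp: P_def)
        ultimately have P: "P \<in> PS h"
          by (simp add: PS_def)
        have V_eq: "insert ?T (relay_labels h - P) = V"
          using V' by (auto simp: P_def)
        have files: "length (F i) = D * m" "length (F' i) = D * m" if "i < N" for i
          using F F' that by (auto simp: files_of_length_def)
        \<comment> \<open>Since \<open>?T\<close> lies in \<open>P\<close>, the index of any other
          summand avoids \<open>?T\<close> and therefore every own label of \<open>k\<close>; that
          symbol is in the cache.\<close>
        have others: "summand d F h P T = summand d F' h P T" if T: "T \<in> P - {?T}" for T
        proof -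
          have Th: "T \<in> relay_labels h" "T \<notin> V"
            using T by (auto simp: P_def)
          then have "insert h T \<subseteq> {..<H}" "card (insert h T) = r"
            using hH r_pos by (auto simp: relay_labels_def card_insert_if finite_subset)
          then have "user (insert h T) < H choose r"
            by (rule user_less)
          then have "d (user (insert h T)) < N"
            using demand_less d by blast
          moreover have "insert T (relay_labels h - P) = insert T (V - {?T})"
            using V' by (auto simp: P_def)
          moreover have "insert T (V - {?T}) \<in> cached_symbols q k"
          proof -
            have "insert T (V - {?T}) \<subseteq> relay_labels h - {?T}"
              using Th V' T by auto
            then have "insert T (V - {?T}) \<subseteq> labels - own_labels k"
              using own_labels_inter_relay_labels[OF k h] relay_labels_subset by blast
            moreover have "card (insert T (V - {?T})) = q"
              using Th V' \<open>finite V\<close> by (simp add: q_def)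
            ultimately show ?thesis
              by (simp add: cached_symbols_def)
          qed
          ultimately show ?thesis
            unfolding summand_def using cached by simp
        qed
        have "finite P"
          using \<open>P \<subseteq> relay_labels h\<close> finite_relay_labels finite_subset by blast
        then have split: "(\<Sum>T\<in>P. summand d G h P T) =
            enc (G (d k)) V + (\<Sum>T\<in>P - {?T}. summand d G h P T)" for G
        proof -
          have "insert h ?T = conn k"
            using h by auto
          then have "summand d G h P ?T = enc (G (d k)) V"
            unfolding summand_def V_eq using user_conn[OF k] by simp
          then show ?thesis
            using sum.remove[OF \<open>finite P\<close>, of ?T "summand d G h P"] by (simp add: P_def)
        qed
        \<comment> \<open>The sums agree modulo \<open>2 ^ L\<close> and so do their cached parts.
          The wanted symbol is below \<open>2 ^ L\<close>, hence it is determined.\<close>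
        have "multicast d F h P = multicast d F' h P"
          using pack_inject[OF finPS xbound xbound bspec[OF X h] P] .
        moreover have "(\<Sum>T\<in>P - {?T}. summand d F h P T) = (\<Sum>T\<in>P - {?T}. summand d F' h P T)"
          using others by (intro sum.cong) auto
        moreover have "enc (F (d k)) V < 2 ^ L" "enc (F' (d k)) V < 2 ^ L"
          using enc files[OF demand_less[OF d k]] V delivered_symbols_subset by blast+
        ultimately show ?thesis
          unfolding multicast_def split by (metis mod_add_right_imp_eq)
      qed
      define J where "J = cached_symbols q k \<union> (\<Union>h\<in>conn k. delivered_symbols q k h)"
      have "card J = D"
        unfolding J_def D_def A_def K'_def by (rule card_known_symbols[OF k]) (simp add: q_def)
      moreover have "J \<subseteq> symbols q"
        unfolding J_def using cached_symbols_subset delivered_symbols_subset by blast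
      moreover have "\<forall>V\<in>J. enc (F (d k)) V = enc (F' (d k)) V"
        unfolding J_def using cached[OF demand_less[OF d k]] delivered by blast
      moreover have "length (F (d k)) = D * m" "length (F' (d k)) = D * m"
        using F F' demand_less[OF d k] by (auto simp: files_of_length_def)
      ultimately show ?thesis
        using mds by blast
    qed
    show ?thesis
      unfolding L_def[symmetric]
    proof (rule zero_error_codeI[where Z = ?Z and X = ?X])
      show "F (d k) = F' (d k)"
        if "d \<in> demands H r N" "k < H choose r" "F \<in> files_of_length N (D * m)"
          "F' \<in> files_of_length N (D * m)" "?Z F k = ?Z F' k" "\<forall>h\<in>conn k. ?X d F h = ?X d F' h"
        for d k F F'
        using that by (rule dec)
    qed (use lenZ lenX in simp_all)
  qed
  then show ?thesis
    by (rule that)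
qed

text \<open>The load follows from \<open>K / H = K' / r\<close>,
  \<open>1 - M / N = r * E / D\<close> and \<open>g * (K' choose g) = K' * E\<close>. What remains
  is to treat file lengths that are not multiples of \<open>D\<close>.\<close>

lemma asymmetric_point_uniformly_achievable:
  fixes g :: nat
  defines "K' \<equiv> (H - 1) choose (r - 1)"
  defines "q \<equiv> K' - g + 1"
  defines "A \<equiv> ((H choose (r - 1)) - r) choose q"
  defines "E \<equiv> (K' - 1) choose (q - 1)"
  defines "M \<equiv> real N * (real A / (real A + real r * real E))"
  assumes g: "0 < g" "g \<le> K'"
  shows "(M, real (H choose r) / real H * (1 - M / real N) / real g) \<in> uniformly_achievable"
proof -
  define D where "D = A + r * E"
  have "q - 1 \<le> K' - 1"
    using g by (simp add: q_def)
  then have D: "0 < D"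
    using r_pos by (simp add: D_def E_def)
  have M: "M = real N * (real A / real D)"
    by (simp add: M_def D_def)
  obtain c where c: "\<And>m. zero_error_code (D * m) (N * A * (m + c)) ((K' choose g) * (m + c))"
    using zero_error_code_asymmetric[of g] g unfolding K'_def q_def A_def D_def E_def by blast
  have load: "real (H choose r) / real H * (1 - M / real N) / real g = real (K' choose g) / real D"
  proof -
    have "r * (H choose r) = H * K'"
      using times_binomial_minus1_eq[OF r_pos, of H] by (simp add: K'_def)
    then have K: "real (H choose r) = real H * real K' / real r"
      using r_pos by (simp add: field_simps flip: of_nat_mult)
    have "1 - M / real N = real r * real E / real D"
      using D N_pos by (simp add: M field_simps) (simp add: D_def)
    moreover have "g * (K' choose g) = K' * E"
    proof -
      \<comment> \<open>Here \<open>q - 1 = K' - g\<close> is complementary to \<open>g - 1\<close>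
        in \<open>K' - 1\<close>.\<close>
      have "E = (K' - 1) choose (g - 1)"
        using g binomial_symmetric[of "g - 1" "K' - 1"] by (simp add: E_def q_def)
      then show ?thesis
        using times_binomial_minus1_eq[OF g(1), of K'] by simp
    qed
    then have "real (K' choose g) = real K' * real E / real g"
      using g by (simp add: field_simps flip: of_nat_mult)
    ultimately show ?thesis
      using H_pos r_pos by (simp add: K)
  qed
  have "\<exists>a s. zero_error_code B a s \<and> real a \<le> M * real B \<and>
      real s \<le> real (K' choose g) / real D * real B + real (N * D * (c + 1))" for B
  \<comment> \<open>Files too short for the overhead \<open>c\<close> have fewer than
    \<open>c * D\<close> bits and are sent uncached within the additive constant.\<close>
  proof (cases "c \<le> B div D")
    case False
    then have "B < c * D"
      using D by (simp add: not_le div_less_iff_less_mult)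
    then have "B \<le> D * (c + 1)"
      by (simp add: algebra_simps)
    then have "N * B \<le> N * D * (c + 1)"
      by (metis mult.assoc mult_le_mono2)
    then have "real (N * B) \<le> real (K' choose g) / real D * real B + real (N * D * (c + 1))"
      by (intro add_increasing) (simp_all only: of_nat_le_iff, simp)
    moreover have "real 0 \<le> M * real B"
      by (simp add: M)
    ultimately show ?thesis
      using zero_error_code_uncached by blast
  next
    case True
    \<comment> \<open>Subtracting \<open>c\<close> makes the full symbol size \<open>m + c\<close>
      equal to \<open>B div D\<close>, so the cached symbols respect the exact bound
      \<open>M * B\<close>. The at most \<open>D * (c + 1)\<close> leftover bits of each file are
      sent uncached.\<close>
    define m where "m = B div D - c"
    define l where "l = B - D * m"
    have mc: "m + c = B div D"
      using True by (simp add: m_def)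
    have DB: "D * (m + c) \<le> B"
      unfolding mc by simp
    then have B: "B = D * m + l"
      by (simp add: l_def algebra_simps)
    have "B < D * (m + c) + D"
      unfolding mc using D by (metis add.commute add_less_cancel_left mod_less_divisor mult_div_mod_eq)
    then have "l \<le> D * (c + 1)"
      unfolding l_def by (simp add: algebra_simps)
    then have l: "N * l \<le> N * D * (c + 1)"
      by (metis mult.assoc mult_le_mono2)
    have piece: "real (m + c) \<le> real B / real D"
      using D DB by (simp add: pos_le_divide_eq mult.commute flip: of_nat_mult of_nat_add)
    have "zero_error_code B (N * A * (m + c) + 0) ((K' choose g) * (m + c) + N * l)"
      unfolding B by (rule zero_error_code_add[OF c zero_error_code_uncached])
    moreover have "real (N * A * (m + c) + 0) \<le> M * real B"
      using mult_left_mono[OF piece, of "real (N * A)"] by (simp add: M)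
    moreover have "real ((K' choose g) * (m + c) + N * l) \<le>
        real (K' choose g) / real D * real B + real (N * D * (c + 1))"
    proof -
      have "real ((K' choose g) * (m + c)) \<le> real (K' choose g) / real D * real B"
        using mult_left_mono[OF piece, of "real (K' choose g)"] by simp
      moreover have "real (N * l) \<le> real (N * D * (c + 1))"
        using l by (simp only: of_nat_le_iff)
      ultimately show ?thesis
        by (simp only: of_nat_add)
    qed
    ultimately show ?thesis
      by blast
  qed
  moreover have "0 \<le> M"
    by (simp add: M)
  moreover have "M \<le> real N"
  proof -
    have "A \<le> D"
      by (simp add: D_def)
    then have "real A / real D \<le> 1"
      using D by simp
    then show ?thesis
      unfolding M by (intro mult_left_le) auto
  qed
  ultimately show ?thesis
    unfolding load uniformly_achievable_def by blast
qed

end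

theorem theorem1:
  fixes H r N :: nat and conn :: "nat \<Rightarrow> nat set"
  assumes "0 < H" and "0 < r" and "r \<le> H" and "0 < N"
    and "connection_map H r conn"
  shows "let K = H choose r;
             K' = (H - 1) choose (r - 1);
             K'' = H choose (r - 1);
             q = (\<lambda>g. K' - g + 1);
             M = (\<lambda>g. real N * (real ((K'' - r) choose q g) /
                   (real ((K'' - r) choose q g) + real r * real ((K' - 1) choose (q g - 1)))));
             R = (\<lambda>g. ((real K / real H) * (1 - M g / real N)) / real g)
         in \<forall>p \<in> lower_convex_envelope ((\<lambda>g. (M g, R g)) ` {2..K'}).
              achievable H r N conn p"
proof -
  interpret combination_network H r N conn
    using assms by unfold_locales
  show ?thesis
    unfolding Let_def
    by (intro achievable_lower_convex_envelope image_subsetI asymmetric_point_uniformly_achievable) auto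
qed

end
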